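(* Let $\rho$ be a Minkowski norm in $\mathbb{R}^d$ whose unit ball is not a polytope. Then, for every integer $n$ there exists a finite family $\mathcal{G}$ of convex sets in $\mathbb{R}^d$ such that the intersection of every $n$ or fewer sets in $\mathcal G$ has $\rho$-diameter greater than or equal to $1$, but the $\rho$-diameter of $\bigcap \mathcal G$ is strictly less than $1$.
   Context: For a compact convex set $K\subseteq\mathbb{R}^d$ with nonempty interior that is symmetric about the origin, the Minkowski norm of $K$ is $\rho_K(x)=\min\{t\ge 0 : x\in tK\}$; its unit ball is $K$. For a Minkowski norm $\rho$, the $\rho$-diameter of a set $A$ is $\sup_{x,y\in A}\rho(x-y)$ (possibly $+\infty$). *)

theory Defs
  imports "HOL-Analysis.Analysis"
begin

definition symmetric_convex_body :: "'a::euclidean_space set \<Rightarrow> bool" where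
  "symmetric_convex_body K \<longleftrightarrow>
     compact K \<and> convex K \<and> interior K \<noteq> {} \<and> (\<forall>x\<in>K. - x \<in> K)"

(* The minimum exists whenever K is a symmetric convex body. *)
definition minkowski_norm :: "'a::euclidean_space set \<Rightarrow> 'a \<Rightarrow> real" where
  "minkowski_norm K x = (LEAST t. 0 \<le> t \<and> x \<in> (\<lambda>y. t *\<^sub>R y) ` K)"

(* Suprema are taken in [0,\<infinity>]; in particular the empty set has diameter 0. *)
definition rho_diameter :: "('a::euclidean_space \<Rightarrow> real) \<Rightarrow> 'a set \<Rightarrow> ennreal" where
  "rho_diameter \<rho> A = (SUP x\<in>A. SUP y\<in>A. ennreal (\<rho> (x - y)))"

end

theory Submission
  imports Defs
begin

text \<open>
  The sets of the family are symmetric strips, the polar description of a symmetric convex body.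
  Write \<open>band u = {x. \<bar>u \<bullet> x\<bar> \<le> 1}\<close>.  A set \<open>Q\<close> that is symmetric about the origin has
  \<open>\<rho>\<close>-diameter less than \<open>1\<close> only if \<open>2x \<in> K\<close> for all \<open>x \<in> Q\<close>, so the problem becomes one
  about intersections of bands that lie inside \<open>K\<close>.

  The role of the hypothesis that \<open>K\<close> is not a polytope is a gap: for each number \<open>N\<close> there is
  \<open>s < 1\<close> such that no \<open>N\<close> bands which all contain \<open>sK\<close> have their intersection inside \<open>K\<close>
  (\<open>few_bands_do_not_fit\<close>).  Otherwise let \<open>s\<close> tend to \<open>1\<close>; the normals of the bands stay
  bounded because \<open>K\<close> contains a ball, so they subconverge, and the \<open>N\<close> limiting bands intersect
  exactly in \<open>K\<close>, which would make \<open>K\<close> a bounded polyhedron.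

  On the other hand finitely many bands, each containing \<open>sK\<close>, do intersect inside \<open>tK\<close> whenever
  \<open>s < t < 1\<close> (\<open>finitely_many_bands_fit\<close>): every point of the compact frontier of \<open>tK\<close> is cut
  off from \<open>sK\<close> by a band, and finitely many of these suffice.  Halving these bands gives the
  family: its whole intersection lies in \<open>(t/2)K\<close> and has diameter at most \<open>t\<close>, while the gap
  prevents any \<open>n\<close> of its members from having an intersection of diameter less than \<open>1\<close>.
\<close>

section \<open>Symmetric convex bodies and their norms\<close>

text \<open>The midpoint of an interior point and its reflection is \<open>0\<close>.\<close>

lemma symmetric_convex_body_contains_cball:
  fixes K :: "'a::euclidean_space set"
  assumes "symmetric_convex_body K"
  obtains e where "e > 0" "cball 0 e \<subseteq> K"
proof -
  have conv: "convex K" and sym: "\<And>x. x \<in> K \<Longrightarrow> - x \<in> K" and "interior K \<noteq> {}"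
    using assms by (auto simp: symmetric_convex_body_def)
  then obtain c where c: "c \<in> interior K" by blast
  have "uminus ` K = K"
    using sym by (auto simp: image_iff) (metis minus_minus)
  then have "- c \<in> interior K"
    using c interior_negations[of K] by (metis imageI)
  then have "(1/2) *\<^sub>R c + (1/2) *\<^sub>R (- c) \<in> interior K"
    using c convexD[OF convex_interior[OF conv], of c "- c" "1/2" "1/2"] by simp
  then have "0 \<in> interior K" by simp
  then show ?thesis
    using that by (auto simp: mem_interior_cball)
qed

text \<open>Compactness of \<open>K\<close> makes the infimum that defines the norm a minimum.\<close>

lemma minkowski_norm_is_least:
  fixes K :: "'a::euclidean_space set"
  assumes K: "symmetric_convex_body K"
  shows "0 \<le> minkowski_norm K x" "x \<in> (\<lambda>y. minkowski_norm K x *\<^sub>R y) ` K"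
    "\<And>t. 0 \<le> t \<Longrightarrow> x \<in> (\<lambda>y. t *\<^sub>R y) ` K \<Longrightarrow> minkowski_norm K x \<le> t"
proof -
  let ?P = "\<lambda>t. 0 \<le> t \<and> x \<in> (\<lambda>y. t *\<^sub>R y) ` K"
  obtain e where e: "e > 0" "cball 0 e \<subseteq> K"
    using symmetric_convex_body_contains_cball[OF K] .
  define T where "T = norm x / e"
  have T: "?P T"
  proof (cases "x = 0")
    case True
    moreover have "0 \<in> K" using e by auto
    ultimately show ?thesis by (auto simp: T_def)
  next
    case False
    then have "(e / norm x) *\<^sub>R x \<in> K" using e by (intro subsetD[OF e(2)]) auto
    moreover have "x = T *\<^sub>R ((e / norm x) *\<^sub>R x)" using False e by (simp add: T_def)
    moreover have "0 \<le> T" using e by (simp add: T_def)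
    ultimately show ?thesis by (intro conjI image_eqI)
  qed
  define Z where "Z = ({0..T} \<times> K) \<inter> {p. fst p *\<^sub>R snd p = x}"
  have "compact Z"
    unfolding Z_def using K
    by (intro compact_Int_closed compact_Times closed_Collect_eq continuous_intros)
       (auto simp: symmetric_convex_body_def)
  then have "compact (fst ` Z)"
    by (intro compact_continuous_image continuous_intros)
  moreover have "fst ` Z \<noteq> {}" using T by (force simp: Z_def)
  ultimately obtain m where m: "m \<in> fst ` Z" "\<And>t. t \<in> fst ` Z \<Longrightarrow> m \<le> t"
    using compact_attains_inf by metis
  have Pm: "?P m" using m(1) by (auto simp: Z_def)
  have "m \<le> t" if "?P t" for t
  proof (cases "t \<le> T")
    case True
    then show ?thesis using that by (intro m(2)) (force simp: Z_def)
  next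
    case False
    then show ?thesis using m(1) by (auto simp: Z_def)
  qed
  moreover from this have "minkowski_norm K x = m"
    unfolding minkowski_norm_def using Pm by (intro Least_equality) auto
  ultimately show "0 \<le> minkowski_norm K x" "x \<in> (\<lambda>y. minkowski_norm K x *\<^sub>R y) ` K"
    "\<And>t. 0 \<le> t \<Longrightarrow> x \<in> (\<lambda>y. t *\<^sub>R y) ` K \<Longrightarrow> minkowski_norm K x \<le> t"
    using Pm by auto
qed

lemma minkowski_norm_le_1_imp_mem:
  fixes K :: "'a::euclidean_space set"
  assumes K: "symmetric_convex_body K" and "minkowski_norm K x \<le> 1"
  shows "x \<in> K"
proof -
  obtain e where "e > 0" "cball 0 e \<subseteq> K"
    using symmetric_convex_body_contains_cball[OF K] .
  then have "0 \<in> K" by auto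
  moreover obtain y where "y \<in> K" "x = minkowski_norm K x *\<^sub>R y"
    using minkowski_norm_is_least(2)[OF K, of x] by blast
  ultimately show ?thesis
    using convexD_alt[of K 0 y "minkowski_norm K x"] K assms(2) minkowski_norm_is_least(1)[OF K, of x]
    by (auto simp: symmetric_convex_body_def)
qed

text \<open>The points \<open>x\<close> and \<open>-x\<close> of \<open>Q\<close> have difference \<open>2x\<close>.\<close>

lemma symmetric_set_small_diameter_imp:
  fixes K :: "'a::euclidean_space set"
  assumes K: "symmetric_convex_body K" and "rho_diameter (minkowski_norm K) Q < 1"
    and "x \<in> Q" "- x \<in> Q"
  shows "2 *\<^sub>R x \<in> K"
proof -
  have "ennreal (minkowski_norm K (x - (- x))) \<le> rho_diameter (minkowski_norm K) Q"
    unfolding rho_diameter_def using assms(3,4) by (intro SUP_upper2[of x] SUP_upper2[of "- x"]) auto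
  then have "ennreal (minkowski_norm K (2 *\<^sub>R x)) < 1"
    using le_less_trans[OF _ assms(2)] by (simp only: scaleR_2 diff_minus_eq_add)
  then have "minkowski_norm K (2 *\<^sub>R x) \<le> 1"
    using minkowski_norm_is_least(1)[OF K] by (simp add: ennreal_less_one_iff)
  then show ?thesis using minkowski_norm_le_1_imp_mem[OF K] by blast
qed

section \<open>Bands containing a shrunken body\<close>

definition band :: "'a::real_inner \<Rightarrow> 'a set" where
  "band u = {x. \<bar>u \<bullet> x\<bar> \<le> 1}"

lemma convex_band: "convex (band u)"
proof -
  have "band u = {x. u \<bullet> x \<le> 1} \<inter> {x. u \<bullet> x \<ge> - 1}"
    by (auto simp: band_def)
  then show ?thesis by (simp add: convex_Int convex_halfspace_le convex_halfspace_ge)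
qed

lemma polyhedron_band: "polyhedron (band (u :: 'a::euclidean_space))"
proof -
  have "band u = {x. u \<bullet> x \<le> 1} \<inter> {x. u \<bullet> x \<ge> - 1}"
    by (auto simp: band_def)
  then show ?thesis by (simp add: polyhedron_Int polyhedron_halfspace_le polyhedron_halfspace_ge)
qed

lemma simultaneous_convergent_subsequence:
  fixes v :: "nat \<Rightarrow> nat \<Rightarrow> 'a::heine_borel"
  assumes "\<And>i. i < N \<Longrightarrow> bounded (range (\<lambda>k. v k i))"
  shows "\<exists>r w. strict_mono (r :: nat \<Rightarrow> nat) \<and> (\<forall>i<N. (\<lambda>k. v (r k) i) \<longlonglongrightarrow> w i)"
  using assms
proof (induction N)
  case 0
  show ?case using strict_mono_id by auto
next
  case (Suc N)
  then obtain r w where r: "strict_mono r" "\<forall>i<N. (\<lambda>k. v (r k) i) \<longlonglongrightarrow> w i"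
    by auto
  have "bounded (range (\<lambda>k. v (r k) N))"
    using Suc.prems[of N] by (auto intro: bounded_subset)
  then obtain l q where q: "strict_mono q" "((\<lambda>k. v (r k) N) \<circ> q) \<longlonglongrightarrow> l"
    using bounded_imp_convergent_subsequence by blast
  have "(\<lambda>k. v ((r \<circ> q) k) i) \<longlonglongrightarrow> (w(N := l)) i" if "i < Suc N" for i
  proof (cases "i = N")
    case True
    then show ?thesis using q(2) by (simp add: o_def)
  next
    case False
    then have "(\<lambda>k. v (r k) i) \<longlonglongrightarrow> w i" using r(2) that by auto
    from LIMSEQ_subseq_LIMSEQ[OF this q(1)] show ?thesis using False by (simp add: o_def)
  qed
  then show ?case using strict_mono_o[OF r(1) q(1)] by blast
qed

text \<open>If there were no gap, then a limit of the configurations would exhibit \<open>K\<close> itself as the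
  intersection of \<open>N\<close> bands.\<close>

lemma few_bands_do_not_fit:
  fixes K :: "'a::euclidean_space set"
  assumes K: "symmetric_convex_body K" and "\<not> polytope K"
  shows "\<exists>s. 0 < s \<and> s < 1 \<and> (\<forall>v :: nat \<Rightarrow> 'a.
    (\<forall>i<N. (*\<^sub>R) s ` K \<subseteq> band (v i)) \<longrightarrow> \<not> (\<Inter>i<N. band (v i)) \<subseteq> K)"
proof (rule ccontr)
  assume no_gap: "\<not> ?thesis"
  have "\<exists>v :: nat \<Rightarrow> 'a. (\<forall>i<N. (*\<^sub>R) s ` K \<subseteq> band (v i)) \<and> (\<Inter>i<N. band (v i)) \<subseteq> K"
    if "0 < s" "s < 1" for s
    using no_gap that by simp
  \<comment> \<open>The shift by \<open>2\<close> keeps \<open>s k\<close> at least \<open>1/2\<close>, which bounds the normals uniformly.\<close>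
  moreover define s where "s k = 1 - inverse (real (k + 2))" for k
  moreover have s: "1/2 \<le> s k" "s k < 1" for k
    by (auto simp: s_def field_simps)
  ultimately have "\<forall>k. \<exists>v :: nat \<Rightarrow> 'a.
      (\<forall>i<N. (*\<^sub>R) (s k) ` K \<subseteq> band (v i)) \<and> (\<Inter>i<N. band (v i)) \<subseteq> K"
    by (metis half_gt_zero less_le_trans zero_less_one)
  then obtain v :: "nat \<Rightarrow> nat \<Rightarrow> 'a" where
    outer: "\<And>k i. i < N \<Longrightarrow> (*\<^sub>R) (s k) ` K \<subseteq> band (v k i)" and
    inner: "\<And>k. (\<Inter>i<N. band (v k i)) \<subseteq> K"
    by metis
  have s_lim: "s \<longlonglongrightarrow> 1"
    unfolding s_def using tendsto_diff[OF tendsto_const[of 1] LIMSEQ_ignore_initial_segment[OF LIMSEQ_inverse_real_of_nat, of 1]]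
    by simp
  obtain e where e: "e > 0" "cball 0 e \<subseteq> K"
    using symmetric_convex_body_contains_cball[OF K] .
  have "norm (v k i) \<le> 2 / e" if "i < N" for k i
  proof (cases "v k i = 0")
    case False
    let ?x = "(e / norm (v k i)) *\<^sub>R v k i"
    have "?x \<in> K" using False e(1) by (intro subsetD[OF e(2)]) auto
    then have "\<bar>v k i \<bullet> (s k *\<^sub>R ?x)\<bar> \<le> 1"
      using outer[OF that, of k] by (auto simp: band_def)
    moreover have "v k i \<bullet> (s k *\<^sub>R ?x) = s k * (e * norm (v k i))"
      using False by (simp add: dot_square_norm power2_eq_square)
    moreover have "1/2 * (e * norm (v k i)) \<le> s k * (e * norm (v k i))"
      using s(1)[of k] e(1) by (intro mult_right_mono) auto
    ultimately have "e * norm (v k i) \<le> 2" by linarith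
    then show ?thesis using e(1) by (simp add: field_simps)
  qed (use e in auto)
  then have "bounded (range (\<lambda>k. v k i))" if "i < N" for i
    using that by (auto simp: bounded_iff)
  then obtain r w where r: "strict_mono (r :: nat \<Rightarrow> nat)"
    and w: "\<And>i. i < N \<Longrightarrow> (\<lambda>k. v (r k) i) \<longlonglongrightarrow> w i"
    using simultaneous_convergent_subsequence[of N v] by blast
  have "K = (\<Inter>i<N. band (w i))"
  proof (intro equalityI subsetI)
    fix x assume "x \<in> K"
    have "\<bar>w i \<bullet> x\<bar> \<le> 1" if "i < N" for i
    proof -
      have "(\<lambda>k. \<bar>v (r k) i \<bullet> (s (r k) *\<^sub>R x)\<bar>) \<longlonglongrightarrow> \<bar>w i \<bullet> (1 *\<^sub>R x)\<bar>"
        by (intro tendsto_intros w that LIMSEQ_subseq_LIMSEQ[OF s_lim r, unfolded o_def])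
      moreover have "\<bar>v (r k) i \<bullet> (s (r k) *\<^sub>R x)\<bar> \<le> 1" for k
        using outer[OF that, of "r k"] \<open>x \<in> K\<close> by (auto simp: band_def)
      ultimately show ?thesis
        by (intro LIMSEQ_le_const2[where x = "\<bar>w i \<bullet> x\<bar>"]) auto
    qed
    then show "x \<in> (\<Inter>i<N. band (w i))" by (auto simp: band_def)
  next
    fix x assume x: "x \<in> (\<Inter>i<N. band (w i))"
    \<comment> \<open>Shrinking \<open>x\<close> makes the limiting inequalities strict, so that they hold before the limit.\<close>
    have "s m *\<^sub>R x \<in> K" for m
    proof -
      have "\<forall>\<^sub>F k in sequentially. \<bar>v (r k) i \<bullet> (s m *\<^sub>R x)\<bar> < 1" if "i < N" for i
      proof (rule order_tendstoD)
        show "(\<lambda>k. \<bar>v (r k) i \<bullet> (s m *\<^sub>R x)\<bar>) \<longlonglongrightarrow> \<bar>w i \<bullet> (s m *\<^sub>R x)\<bar>"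
          by (intro tendsto_intros w that)
        have "\<bar>w i \<bullet> x\<bar> \<le> 1" using x that by (auto simp: band_def)
        then have "s m * \<bar>w i \<bullet> x\<bar> \<le> s m" using s(1)[of m] by (simp add: mult_left_le)
        then have "s m * \<bar>w i \<bullet> x\<bar> < 1" using s(2)[of m] by linarith
        then show "\<bar>w i \<bullet> (s m *\<^sub>R x)\<bar> < 1"
          using s(1)[of m] by (simp add: abs_mult)
      qed
      then have "\<forall>\<^sub>F k in sequentially. \<forall>i\<in>{..<N}. \<bar>v (r k) i \<bullet> (s m *\<^sub>R x)\<bar> < 1"
        by (intro eventually_ball_finite) auto
      then obtain k where "\<forall>i\<in>{..<N}. \<bar>v (r k) i \<bullet> (s m *\<^sub>R x)\<bar> < 1"
        by (auto dest: eventually_happens)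
      then have "s m *\<^sub>R x \<in> (\<Inter>i<N. band (v (r k) i))"
        by (auto simp: band_def intro: less_imp_le)
      then show ?thesis using inner by blast
    qed
    moreover have "(\<lambda>m. s m *\<^sub>R x) \<longlonglongrightarrow> 1 *\<^sub>R x"
      by (intro tendsto_intros s_lim)
    moreover have "closed K" using K by (simp add: symmetric_convex_body_def compact_imp_closed)
    ultimately show "x \<in> K"
      using closed_sequentially[of K "\<lambda>m. s m *\<^sub>R x"] by simp
  qed
  moreover have "polyhedron (\<Inter>i<N. band (w i))"
    by (intro polyhedron_Inter) (auto simp: polyhedron_band)
  moreover have "bounded K" using K by (simp add: symmetric_convex_body_def compact_imp_bounded)
  ultimately show False
    using \<open>\<not> polytope K\<close> by (simp add: polytope_eq_bounded_polyhedron)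
qed

text \<open>A linear functional separating a point from a symmetric set bounds that set from both sides.\<close>

lemma separating_band:
  fixes C :: "'a::euclidean_space set"
  assumes "convex C" "closed C" "0 \<in> C" "\<And>x. x \<in> C \<Longrightarrow> - x \<in> C" "z \<notin> C"
  obtains u where "C \<subseteq> band u" "z \<notin> band u"
proof -
  obtain a b where ab: "a \<bullet> z < b" "\<And>x. x \<in> C \<Longrightarrow> b < a \<bullet> x"
    using separating_hyperplane_closed_point[OF assms(1,2,5)] by blast
  have "b < 0" using ab(2)[OF \<open>0 \<in> C\<close>] by simp
  define u where "u = (1 / b) *\<^sub>R a"
  have "\<bar>u \<bullet> x\<bar> \<le> 1" if "x \<in> C" for x
  proof -
    have "\<bar>a \<bullet> x\<bar> \<le> - b" using ab(2)[OF that] ab(2)[OF assms(4)[OF that]] by auto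
    then show ?thesis using \<open>b < 0\<close> by (simp add: u_def abs_mult abs_divide field_simps)
  qed
  moreover have "u \<bullet> z > 1" using ab(1) \<open>b < 0\<close> by (simp add: u_def field_simps)
  ultimately show ?thesis
    using that[of u] by (auto simp: band_def)
qed

text \<open>Since \<open>sK\<close> lies in the interior of \<open>K\<close>, each frontier point of \<open>K\<close> lies in the open
  complement of some band around \<open>sK\<close>; compactness of the frontier leaves finitely many.\<close>

lemma finitely_many_bands_fit_unscaled:
  fixes K :: "'a::euclidean_space set"
  assumes K: "symmetric_convex_body K" and s: "0 < s" "s < 1"
  obtains F where "finite F" "\<And>u. u \<in> F \<Longrightarrow> (*\<^sub>R) s ` K \<subseteq> band u" "(\<Inter>u\<in>F. band u) \<subseteq> K"
proof -
  have conv: "convex K" and comp: "compact K" and sym: "\<And>x. x \<in> K \<Longrightarrow> - x \<in> K"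
    using K by (auto simp: symmetric_convex_body_def)
  obtain e where e: "e > 0" "cball 0 e \<subseteq> K"
    using symmetric_convex_body_contains_cball[OF K] .
  then have "0 \<in> interior K" by (auto simp: mem_interior_cball)
  then have shrunk: "s *\<^sub>R x \<in> interior K" if "x \<in> K" for x
    using mem_interior_convex_shrink[OF conv, of 0 x "1 - s"] that s by (simp add: algebra_simps)
  have "0 \<in> K" using e by auto
  let ?C = "(*\<^sub>R) s ` K"
  have "\<exists>u. ?C \<subseteq> band u \<and> z \<notin> band u" if z: "z \<in> frontier K" for z
  proof (rule separating_band[of ?C z])
    show "convex ?C" using conv by (rule convex_scaling)
    show "closed ?C" using comp by (intro compact_imp_closed compact_scaling)
    show "0 \<in> ?C" using \<open>0 \<in> K\<close> by force
    show "- x \<in> ?C" if "x \<in> ?C" for x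
      using that sym by (auto simp flip: scaleR_minus_right)
    show "z \<notin> ?C" using z shrunk by (auto simp: frontier_def)
  qed blast
  then obtain f where f: "\<And>z. z \<in> frontier K \<Longrightarrow> ?C \<subseteq> band (f z) \<and> z \<notin> band (f z)"
    by metis
  have "closed (band u)" for u :: 'a
    unfolding band_def by (intro closed_Collect_le continuous_intros)
  then have "open (- band u)" for u :: 'a
    by (simp add: open_Compl)
  then obtain Z where Z: "Z \<subseteq> frontier K" "finite Z" "frontier K \<subseteq> (\<Union>z\<in>Z. - band (f z))"
  proof (rule compactE_image[OF compact_frontier[OF comp], of "frontier K" "\<lambda>z. - band (f z)"])
    show "frontier K \<subseteq> (\<Union>z\<in>frontier K. - band (f z))" using f by blast
  qed auto
  \<comment> \<open>The intersection is connected, contains \<open>0\<close> and misses the frontier of \<open>K\<close>.\<close>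
  have "(\<Inter>u\<in>f ` Z. band u) \<subseteq> K"
  proof (rule ccontr)
    let ?B = "\<Inter>u\<in>f ` Z. band u"
    assume "\<not> ?B \<subseteq> K"
    moreover have "0 \<in> ?B" by (auto simp: band_def)
    moreover have "connected ?B"
      by (intro convex_connected convex_INT convex_band)
    ultimately have "?B \<inter> frontier K \<noteq> {}"
      using \<open>0 \<in> K\<close> by (intro connected_Int_frontier) auto
    then show False using Z(3) by auto
  qed
  then show ?thesis
    using that[of "f ` Z"] Z f by blast
qed

lemma finitely_many_bands_fit:
  fixes K :: "'a::euclidean_space set"
  assumes K: "symmetric_convex_body K" and st: "0 < s" "s < t"
  obtains F where "finite F" "\<And>u. u \<in> F \<Longrightarrow> (*\<^sub>R) s ` K \<subseteq> band u"
    "(\<Inter>u\<in>F. band u) \<subseteq> (*\<^sub>R) t ` K"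
proof -
  obtain F where F: "finite F" "\<And>u. u \<in> F \<Longrightarrow> (*\<^sub>R) (s / t) ` K \<subseteq> band u" "(\<Inter>u\<in>F. band u) \<subseteq> K"
    using finitely_many_bands_fit_unscaled[OF K, of "s / t"] st by auto
  have band_scaled: "x \<in> band ((1 / t) *\<^sub>R u) \<longleftrightarrow> (1 / t) *\<^sub>R x \<in> band u" for u x :: 'a
    by (simp add: band_def)
  show ?thesis
  proof (rule that[of "(*\<^sub>R) (1 / t) ` F"])
    show "finite ((*\<^sub>R) (1 / t) ` F)" using F(1) by simp
    show "(*\<^sub>R) s ` K \<subseteq> band u" if u: "u \<in> (*\<^sub>R) (1 / t) ` F" for u
      using u F(2) by (fastforce simp: band_scaled)
    show "(\<Inter>u\<in>(*\<^sub>R) (1 / t) ` F. band u) \<subseteq> (*\<^sub>R) t ` K"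
    proof
      fix x assume "x \<in> (\<Inter>u\<in>(*\<^sub>R) (1 / t) ` F. band u)"
      then have "(1 / t) *\<^sub>R x \<in> K" using F(3) by (auto simp: band_scaled)
      moreover have "x = t *\<^sub>R ((1 / t) *\<^sub>R x)" using st by simp
      ultimately show "x \<in> (*\<^sub>R) t ` K" by blast
    qed
  qed
qed

section \<open>The family\<close>

text \<open>The members are the half-size bands \<open>(1/2) band u\<close>, written \<open>band (2u)\<close>.\<close>

lemma no_helly_number_for_diameter:
  fixes K :: "'a::euclidean_space set"
  assumes K: "symmetric_convex_body K" and np: "\<not> polytope K"
  shows "\<exists>\<G>. finite \<G> \<and> (\<forall>S\<in>\<G>. convex S) \<and>
    (\<forall>\<H>. \<H> \<subseteq> \<G> \<and> card \<H> \<le> N \<longrightarrow> rho_diameter (minkowski_norm K) (\<Inter>\<H>) \<ge> 1) \<and>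
    rho_diameter (minkowski_norm K) (\<Inter>\<G>) < 1"
proof -
  obtain s where s: "0 < s" "s < 1" and
    gap: "\<forall>v :: nat \<Rightarrow> 'a.
      (\<forall>i<N. (*\<^sub>R) s ` K \<subseteq> band (v i)) \<longrightarrow> \<not> (\<Inter>i<N. band (v i)) \<subseteq> K"
    using few_bands_do_not_fit[OF K np, of N] by auto
  define t where "t = (s + 1) / 2"
  have t: "s < t" "t < 1" "0 < t" using s by (auto simp: t_def)
  obtain F where F: "finite F" "\<And>u. u \<in> F \<Longrightarrow> (*\<^sub>R) s ` K \<subseteq> band u"
    "(\<Inter>u\<in>F. band u) \<subseteq> (*\<^sub>R) t ` K"
    using finitely_many_bands_fit[OF K s(1) t(1)] by blast
  define \<G> where "\<G> = (\<lambda>u. band (2 *\<^sub>R u)) ` F"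
  have band_2: "x \<in> band (2 *\<^sub>R u) \<longleftrightarrow> 2 *\<^sub>R x \<in> band u" for u x :: 'a
    by (simp add: band_def)
  have conv: "convex K" and sym: "\<And>x. x \<in> K \<Longrightarrow> - x \<in> K"
    using K by (auto simp: symmetric_convex_body_def)
  have "rho_diameter (minkowski_norm K) (\<Inter>\<H>) \<ge> 1" if \<H>: "\<H> \<subseteq> \<G>" "card \<H> \<le> N" for \<H>
  proof (rule ccontr)
    assume "\<not> ?thesis"
    then have small: "rho_diameter (minkowski_norm K) (\<Inter>\<H>) < 1" by simp
    have "finite \<H>" using \<H>(1) F(1) by (auto simp: \<G>_def intro: finite_subset)
    then obtain h where h: "bij_betw h {0..<card \<H>} \<H>"
      using ex_bij_betw_nat_finite by blast
    have "\<exists>u. u \<in> F \<and> h i = band (2 *\<^sub>R u)" if "i < card \<H>" for i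
    proof -
      have "h i \<in> \<G>" using bij_betwE[OF h] that \<H>(1) by auto
      then show ?thesis by (auto simp: \<G>_def)
    qed
    then obtain g where g: "\<And>i. i < card \<H> \<Longrightarrow> g i \<in> F \<and> h i = band (2 *\<^sub>R g i)"
      by metis
    \<comment> \<open>Pad with \<open>band 0 = UNIV\<close> to reach exactly \<open>N\<close> bands.\<close>
    define v where "v i = (if i < card \<H> then g i else 0)" for i
    have "\<forall>i<N. (*\<^sub>R) s ` K \<subseteq> band (v i)"
      using g F(2) by (auto simp: v_def) (auto simp: band_def)
    then obtain y where y: "y \<in> (\<Inter>i<N. band (v i))" "y \<notin> K"
      using gap by blast
    define x where "x = (1/2) *\<^sub>R y"
    have "x \<in> S \<and> - x \<in> S" if "S \<in> \<H>" for S
    proof -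
      have "S \<in> h ` {0..<card \<H>}"
        using that by (simp only: bij_betw_imp_surj_on[OF h])
      then obtain i where i: "i < card \<H>" "S = h i" by auto
      then have "i < N" "v i = g i" using \<H>(2) by (simp_all add: v_def)
      then have "y \<in> band (g i)" using INT_D[OF y(1), of i] by simp
      then show ?thesis using g[OF i(1)] i(2) by (simp add: x_def band_def)
    qed
    then have "2 *\<^sub>R x \<in> K"
      by (intro symmetric_set_small_diameter_imp[OF K small]) auto
    then show False using y(2) by (simp add: x_def)
  qed
  moreover have "rho_diameter (minkowski_norm K) (\<Inter>\<G>) < 1"
  proof -
    have "minkowski_norm K (x - y) \<le> t" if xy: "x \<in> \<Inter>\<G>" "y \<in> \<Inter>\<G>" for x y
    proof -
      have "2 *\<^sub>R x \<in> (*\<^sub>R) t ` K" "2 *\<^sub>R y \<in> (*\<^sub>R) t ` K"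
        using xy by (auto simp: \<G>_def band_2 intro!: subsetD[OF F(3)])
      then obtain a b where ab: "a \<in> K" "2 *\<^sub>R x = t *\<^sub>R a" "b \<in> K" "2 *\<^sub>R y = t *\<^sub>R b"
        by auto
      have "(1/2) *\<^sub>R a + (1/2) *\<^sub>R (- b) \<in> K"
        using ab sym by (intro convexD[OF conv]) auto
      moreover have "x - y = (1/2) *\<^sub>R (2 *\<^sub>R x) - (1/2) *\<^sub>R (2 *\<^sub>R y)" by simp
      then have "x - y = t *\<^sub>R ((1/2) *\<^sub>R a + (1/2) *\<^sub>R (- b))"
        unfolding ab by (simp add: algebra_simps)
      ultimately show ?thesis
        using t by (intro minkowski_norm_is_least(3)[OF K]) auto
    qed
    then have "rho_diameter (minkowski_norm K) (\<Inter>\<G>) \<le> ennreal t"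
      unfolding rho_diameter_def by (intro SUP_least ennreal_leI) auto
    also have "\<dots> < 1" using t by (simp add: ennreal_less_one_iff)
    finally show ?thesis .
  qed
  moreover have "finite \<G>" "\<forall>S\<in>\<G>. convex S"
    using F(1) by (auto simp: \<G>_def convex_band)
  ultimately show ?thesis by blast
qed

theorem theorem3p7:
  fixes K :: "(real ^ 'd) set" and n :: int
  assumes "symmetric_convex_body K"
    and "\<not> polytope K"
  shows "\<exists>\<G> :: (real ^ 'd) set set.
           finite \<G> \<and> (\<forall>S\<in>\<G>. convex S) \<and>
           (\<forall>\<H>. \<H> \<subseteq> \<G> \<and> int (card \<H>) \<le> n \<longrightarrow> rho_diameter (minkowski_norm K) (\<Inter>\<H>) \<ge> 1) \<and>
           rho_diameter (minkowski_norm K) (\<Inter>\<G>) < 1"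
proof -
  have "card \<H> \<le> nat n" if "int (card \<H>) \<le> n" for \<H> :: "(real ^ 'd) set set"
    using that by linarith
  then show ?thesis
    using no_helly_number_for_diameter[OF assms, of "nat n"] by blast
qed

end
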